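(* Let $G$ be a finitely generated non-elementary hyperbolic group, $X$ a finite generating set, and $P$ a positive cone of $G$. Then there do not exist $\lambda\ge1$, $c\ge0$, $r\ge0$ and a $(\lambda,c)$-quasi-geodesic combing of $P$ in $\Gamma(G,X)$ supported on the $r$-neighbourhood of $P$.
   Context: A positive cone of $G$ is a subsemigroup $P$ with $G=P\sqcup P^{-1}\sqcup\{1\}$. A group is non-elementary hyperbolic if it is Gromov hyperbolic and not virtually cyclic. A path in $\Gamma(G,X)$ is a sequence $v_0,\dots,v_k$ of elements with $v_{i+1}$ equal or adjacent to $v_i$; it is a $(\lambda,c)$-quasi-geodesic if $|i-j|/\lambda-c\le d_X(v_i,v_j)$ for all $i,j$. A $(\lambda,c)$-quasi-geodesic combing of $P$ is a set $\mathcal{P}$ of $(\lambda,c)$-quasi-geodesic paths starting at $1_G$ and ending in $P$ such that every $g\in P$ is the endpoint of at least one path of $\mathcal{P}$. It is supported on the $r$-neighbourhood of $P$ if every vertex of every path of $\mathcal{P}$ lies in $\bigcup_{g\in P}\mathbb{B}_X(g,r)$. *)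

theory Defs
  imports "HOL-Algebra.Algebra"
begin

definition sym_gens :: "('a, 'b) monoid_scheme \<Rightarrow> 'a set \<Rightarrow> 'a set" where
  "sym_gens G S = S \<union> m_inv G ` S"

definition cayley_adj :: "('a, 'b) monoid_scheme \<Rightarrow> 'a set \<Rightarrow> 'a \<Rightarrow> 'a \<Rightarrow> bool" where
  "cayley_adj G S g h \<longleftrightarrow> g \<in> carrier G \<and> h \<in> carrier G \<and>
     (\<exists>s\<in>sym_gens G S. h = monoid.mult G g s)"

definition word_dist :: "('a, 'b) monoid_scheme \<Rightarrow> 'a set \<Rightarrow> 'a \<Rightarrow> 'a \<Rightarrow> nat" where
  "word_dist G S g h = (LEAST n. \<exists>ws. length ws = n \<and> set ws \<subseteq> sym_gens G S \<and>
      h = monoid.mult G g (foldr (monoid.mult G) ws (monoid.one G)))"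

definition gromov_prod :: "('a, 'b) monoid_scheme \<Rightarrow> 'a set \<Rightarrow> 'a \<Rightarrow> 'a \<Rightarrow> 'a \<Rightarrow> real" where
  "gromov_prod G S w x y =
     (real (word_dist G S x w) + real (word_dist G S y w) - real (word_dist G S x y)) / 2"

definition gromov_hyperbolic_group :: "('a, 'b) monoid_scheme \<Rightarrow> 'a set \<Rightarrow> bool" where
  "gromov_hyperbolic_group G S \<longleftrightarrow> (\<exists>\<delta>::real. \<delta> \<ge> 0 \<and>
     (\<forall>w\<in>carrier G. \<forall>x\<in>carrier G. \<forall>y\<in>carrier G. \<forall>z\<in>carrier G.
        gromov_prod G S w x z \<ge> min (gromov_prod G S w x y) (gromov_prod G S w y z) - \<delta>))"

definition virtually_cyclic :: "('a, 'b) monoid_scheme \<Rightarrow> bool" where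
  "virtually_cyclic G \<longleftrightarrow> (\<exists>H. subgroup H G \<and> finite (RCOSETS G H) \<and>
     (\<exists>a\<in>H. H = generate G {a}))"

definition positive_cone :: "('a, 'b) monoid_scheme \<Rightarrow> 'a set \<Rightarrow> bool" where
  "positive_cone G P \<longleftrightarrow> P \<subseteq> carrier G \<and>
     (\<forall>a\<in>P. \<forall>b\<in>P. monoid.mult G a b \<in> P) \<and>
     carrier G = P \<union> m_inv G ` P \<union> {monoid.one G} \<and>
     P \<inter> m_inv G ` P = {} \<and> monoid.one G \<notin> P \<and>
     monoid.one G \<notin> m_inv G ` P"

definition cayley_path :: "('a, 'b) monoid_scheme \<Rightarrow> 'a set \<Rightarrow> 'a list \<Rightarrow> bool" where
  "cayley_path G S p \<longleftrightarrow> p \<noteq> [] \<and> set p \<subseteq> carrier G \<and>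
     (\<forall>i. Suc i < length p \<longrightarrow> p ! Suc i = p ! i \<or> cayley_adj G S (p ! i) (p ! Suc i))"

definition quasi_geodesic :: "('a, 'b) monoid_scheme \<Rightarrow> 'a set \<Rightarrow> real \<Rightarrow> real \<Rightarrow> 'a list \<Rightarrow> bool" where
  "quasi_geodesic G S lam c p \<longleftrightarrow> cayley_path G S p \<and>
     (\<forall>i<length p. \<forall>j<length p.
        \<bar>real i - real j\<bar> / lam - c \<le> real (word_dist G S (p ! i) (p ! j)))"

definition qg_combing :: "('a, 'b) monoid_scheme \<Rightarrow> 'a set \<Rightarrow> real \<Rightarrow> real \<Rightarrow> 'a set \<Rightarrow> 'a list set \<Rightarrow> bool" where
  "qg_combing G S lam c P \<P> \<longleftrightarrow>
     (\<forall>p\<in>\<P>. quasi_geodesic G S lam c p \<and> hd p = monoid.one G \<and> last p \<in> P) \<and>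
     (\<forall>g\<in>P. \<exists>p\<in>\<P>. last p = g)"

definition supported_nbhd :: "('a, 'b) monoid_scheme \<Rightarrow> 'a set \<Rightarrow> real \<Rightarrow> 'a set \<Rightarrow> 'a list set \<Rightarrow> bool" where
  "supported_nbhd G S r P \<P> \<longleftrightarrow>
     (\<forall>p\<in>\<P>. \<forall>v\<in>set p. \<exists>g\<in>P. real (word_dist G S g v) \<le> r)"

end

theory Submission
  imports Defs "HOL-Real_Asymp.Real_Asymp"
begin

text \<open>Order \<open>G\<close> by \<open>x < y\<close> iff \<open>x\<inverse>y \<in> P\<close>. If \<open>f\<close> exceeds every element of the ball of radius \<open>R\<close>
  around \<open>1\<close>, then the ball of radius \<open>R\<close> around \<open>f\<inverse>\<close> misses \<open>P\<close>. For every \<open>a \<noteq> 1\<close>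
  one of \<open>a f\<close>, \<open>a\<inverse> f\<close> is a \<open>k > f\<close>, so \<open>f\<inverse> k\<close> lies in \<open>P\<close>. If moreover the Gromov product of
  \<open>f\<close> and \<open>k\<close> at \<open>1\<close> is bounded independently of \<open>R\<close>, then so is that of \<open>1\<close> and \<open>f\<inverse> k\<close> at \<open>f\<inverse>\<close>;
  the combing path from \<open>1\<close> to \<open>f\<inverse> k\<close> therefore passes uniformly close to \<open>f\<inverse>\<close>, which is absurd for large \<open>R\<close>.

  Such an \<open>a\<close> can be chosen in a fixed ball: otherwise arbitrarily large balls almost fix the direction
  of some \<open>f\<close>, which forces linear growth, and a group of linear growth with an element of infinite
  order is virtually cyclic.\<close>

section \<open>Word metrics\<close>

locale word_metric = group G for G (structure) +
  fixes S
  assumes finite_gens: "finite S" and gens_closed: "S \<subseteq> carrier G"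
    and gens_generate: "generate G S = carrier G"
begin

abbreviation wd :: "'a \<Rightarrow> 'a \<Rightarrow> nat" where "wd \<equiv> word_dist G S"
abbreviation wprod :: "'a list \<Rightarrow> 'a" where "wprod ws \<equiv> foldr (\<otimes>) ws \<one>"
abbreviation wball :: "nat \<Rightarrow> 'a set" where "wball n \<equiv> {x \<in> carrier G. wd \<one> x \<le> n}"

lemma sym_gens_closed: "sym_gens G S \<subseteq> carrier G"
  using gens_closed by (auto simp: sym_gens_def)

lemma sym_gens_inv: "s \<in> sym_gens G S \<Longrightarrow> inv s \<in> sym_gens G S"
  using gens_closed by (auto simp: sym_gens_def)

lemma wprod_closed: "set ws \<subseteq> sym_gens G S \<Longrightarrow> wprod ws \<in> carrier G"
  using sym_gens_closed by (induction ws) auto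

lemma wprod_append:
  "\<lbrakk>set us \<subseteq> sym_gens G S; set ws \<subseteq> sym_gens G S\<rbrakk> \<Longrightarrow> wprod (us @ ws) = wprod us \<otimes> wprod ws"
proof (induction us)
  case (Cons u us)
  then show ?case
    using sym_gens_closed wprod_closed[of us] wprod_closed[of ws] by (auto simp: m_assoc subset_iff)
qed (simp add: wprod_closed)

lemma wprod_rev_inv:
  "set ws \<subseteq> sym_gens G S \<Longrightarrow> wprod (rev (map (m_inv G) ws)) = inv (wprod ws)"
proof (induction ws)
  case (Cons w ws)
  have "set (rev (map (m_inv G) ws)) \<subseteq> sym_gens G S" "inv w \<in> sym_gens G S"
    using Cons.prems sym_gens_inv by auto
  then show ?case
    using Cons sym_gens_closed wprod_closed[of ws]
    by (auto simp: wprod_append inv_mult_group subset_iff simp del: foldr_append)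
qed simp

lemma ex_word: assumes "x \<in> carrier G" shows "\<exists>ws. set ws \<subseteq> sym_gens G S \<and> wprod ws = x"
proof -
  have "x \<in> generate G S" using assms gens_generate by simp
  then show ?thesis
  proof induction
    case one
    then show ?case by (intro exI[of _ "[]"]) auto
  next
    case (incl h)
    then show ?case using gens_closed by (intro exI[of _ "[h]"]) (auto simp: sym_gens_def)
  next
    case (inv h)
    then show ?case using gens_closed by (intro exI[of _ "[inv h]"]) (auto simp: sym_gens_def)
  next
    case (eng h1 h2)
    then obtain us ws where "set us \<subseteq> sym_gens G S" "wprod us = h1"
      "set ws \<subseteq> sym_gens G S" "wprod ws = h2" by blast
    then show ?case by (intro exI[of _ "us @ ws"]) (use wprod_append in auto)
  qed
qed

lemma wd_le: "\<lbrakk>set ws \<subseteq> sym_gens G S; y = x \<otimes> wprod ws\<rbrakk> \<Longrightarrow> wd x y \<le> length ws"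
  unfolding word_dist_def by (rule Least_le) blast

lemma wd_word:
  assumes "x \<in> carrier G" "y \<in> carrier G"
  obtains ws where "length ws = wd x y" "set ws \<subseteq> sym_gens G S" "y = x \<otimes> wprod ws"
proof -
  obtain ws where "set ws \<subseteq> sym_gens G S" "wprod ws = inv x \<otimes> y"
    using ex_word[of "inv x \<otimes> y"] assms by auto
  then have "\<exists>n ws. length ws = n \<and> set ws \<subseteq> sym_gens G S \<and> y = x \<otimes> wprod ws"
    using assms by (metis inv_solve_left m_closed inv_closed)
  then show thesis using that LeastI_ex[of "\<lambda>n. \<exists>ws. length ws = n \<and> set ws \<subseteq> sym_gens G S \<and>
      y = x \<otimes> wprod ws"]
    unfolding word_dist_def by blast
qed

lemma wd_refl [simp]: "x \<in> carrier G \<Longrightarrow> wd x x = 0"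
  using wd_le[of "[]" x x] by simp

lemma wd_triangle:
  assumes "x \<in> carrier G" "y \<in> carrier G" "z \<in> carrier G"
  shows "wd x z \<le> wd x y + wd y z"
proof -
  obtain us ws where *: "length us = wd x y" "set us \<subseteq> sym_gens G S" "y = x \<otimes> wprod us"
    "length ws = wd y z" "set ws \<subseteq> sym_gens G S" "z = y \<otimes> wprod ws"
    using assms wd_word by metis
  have "z = x \<otimes> wprod (us @ ws)"
    using assms(1) wprod_append[OF *(2,5)] wprod_closed[OF *(2)] wprod_closed[OF *(5)]
    by (simp add: *(6) *(3) m_assoc del: foldr_append)
  then show ?thesis using wd_le[of "us @ ws" z x] *(1,2,4,5) by simp
qed

lemma wd_commute:
  assumes "x \<in> carrier G" "y \<in> carrier G"
  shows "wd x y = wd y x"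
proof -
  have "wd b a \<le> wd a b" if ab: "a \<in> carrier G" "b \<in> carrier G" for a b
  proof -
    obtain ws where ws: "length ws = wd a b" "set ws \<subseteq> sym_gens G S" "b = a \<otimes> wprod ws"
      using wd_word ab by blast
    have "set (rev (map (m_inv G) ws)) \<subseteq> sym_gens G S"
      using ws sym_gens_inv by auto
    moreover have "a = b \<otimes> wprod (rev (map (m_inv G) ws))"
      unfolding wprod_rev_inv[OF ws(2)] ws(3) using ab wprod_closed[OF ws(2)] by (simp add: m_assoc)
    ultimately have "wd b a \<le> length (rev (map (m_inv G) ws))" by (rule wd_le)
    then show ?thesis using ws(1) by simp
  qed
  then show ?thesis using assms by (simp add: order_antisym)
qed

lemma wd_left_mult:
  assumes "g \<in> carrier G" "x \<in> carrier G" "y \<in> carrier G"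
  shows "wd (g \<otimes> x) (g \<otimes> y) = wd x y"
proof -
  have "g \<otimes> y = g \<otimes> x \<otimes> w \<longleftrightarrow> y = x \<otimes> w" if "w \<in> carrier G" for w
    using that assms by (simp add: m_assoc)
  then have "(\<exists>ws. length ws = n \<and> set ws \<subseteq> sym_gens G S \<and> g \<otimes> y = g \<otimes> x \<otimes> wprod ws) \<longleftrightarrow>
     (\<exists>ws. length ws = n \<and> set ws \<subseteq> sym_gens G S \<and> y = x \<otimes> wprod ws)" for n
    using wprod_closed by blast
  then show ?thesis unfolding word_dist_def by simp
qed

lemma wd_one_inv_mult:
  assumes "x \<in> carrier G" "y \<in> carrier G"
  shows "wd \<one> (inv x \<otimes> y) = wd x y"
  using wd_left_mult[of x \<one> "inv x \<otimes> y"] assms by (simp add: m_assoc[symmetric])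

text \<open>Cutting a shortest word after \<open>s\<close> letters gives the point. Geodesics enter
  the proof only through such points.\<close>

lemma wd_geodesic:
  assumes "x \<in> carrier G" "y \<in> carrier G" "s \<le> wd x y"
  shows "\<exists>z\<in>carrier G. wd x z = s \<and> wd z y = wd x y - s"
proof -
  obtain ws where ws: "length ws = wd x y" "set ws \<subseteq> sym_gens G S" "y = x \<otimes> wprod ws"
    using wd_word assms by blast
  let ?u = "take s ws" and ?v = "drop s ws"
  have sub: "set ?u \<subseteq> sym_gens G S" "set ?v \<subseteq> sym_gens G S"
    using ws(2) by (meson set_take_subset set_drop_subset subset_trans)+
  define z where "z = x \<otimes> wprod ?u"
  have z: "z \<in> carrier G" using assms wprod_closed[OF sub(1)] z_def by simp
  have "wprod ws = wprod ?u \<otimes> wprod ?v" using wprod_append[OF sub] by simp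
  then have y: "y = z \<otimes> wprod ?v"
    using ws(3) z_def assms wprod_closed[OF sub(1)] wprod_closed[OF sub(2)] by (simp add: m_assoc)
  have "wd x z \<le> s" "wd z y \<le> wd x y - s"
    using wd_le[OF sub(1) z_def] wd_le[OF sub(2) y] ws(1) assms(3) by auto
  with wd_triangle[of x z y] z assms show ?thesis by (intro bexI[of _ z]) auto
qed

lemma wd_adjacent: "cayley_adj G S x y \<Longrightarrow> wd x y \<le> 1"
  using wd_le[of "[_]" y x] sym_gens_closed by (fastforce simp: cayley_adj_def)

lemma finite_wball: "finite (wball n)"
proof -
  have fin: "finite (sym_gens G S)" using finite_gens by (simp add: sym_gens_def)
  have "wball n \<subseteq> wprod ` {ws. set ws \<subseteq> sym_gens G S \<and> length ws \<le> n}"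
  proof
    fix x assume x: "x \<in> wball n"
    then obtain ws where "length ws = wd \<one> x" "set ws \<subseteq> sym_gens G S" "x = \<one> \<otimes> wprod ws"
      using wd_word[of \<one> x] by auto
    with x show "x \<in> wprod ` {ws. set ws \<subseteq> sym_gens G S \<and> length ws \<le> n}"
      using wprod_closed by auto
  qed
  then show ?thesis
    using finite_lists_length_le[OF fin] finite_surj by blast
qed

lemma wball_mult: "\<lbrakk>x \<in> wball m; y \<in> wball n\<rbrakk> \<Longrightarrow> x \<otimes> y \<in> wball (m + n)"
  using wd_triangle[of \<one> x "x \<otimes> y"] wd_left_mult[of x \<one> y] by auto

lemma wball_pow: "g \<in> carrier G \<Longrightarrow> g [^] (n::nat) \<in> wball (n * wd \<one> g)"
proof (induction n)
  case (Suc n)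
  then show ?case using wball_mult[of "g [^] n" "n * wd \<one> g" g "wd \<one> g"] by (simp add: add.commute)
qed simp

section \<open>Gromov products in a word metric\<close>

lemma gromov_prod_commute:
  "\<lbrakk>x \<in> carrier G; y \<in> carrier G\<rbrakk> \<Longrightarrow> gromov_prod G S w x y = gromov_prod G S w y x"
  using wd_commute by (simp add: gromov_prod_def)

lemma gromov_prod_le:
  assumes "w \<in> carrier G" "x \<in> carrier G" "y \<in> carrier G"
  shows "gromov_prod G S w x y \<le> wd w x"
  using wd_triangle[of y x w] assms wd_commute[of w x] wd_commute[of x y]
  unfolding gromov_prod_def by simp

lemma gromov_prod_left_mult:
  "\<lbrakk>g \<in> carrier G; w \<in> carrier G; x \<in> carrier G; y \<in> carrier G\<rbrakk> \<Longrightarrow>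
    gromov_prod G S (g \<otimes> w) (g \<otimes> x) (g \<otimes> y) = gromov_prod G S w x y"
  by (simp add: gromov_prod_def wd_left_mult)

lemma gromov_prod_change_base:
  assumes "w \<in> carrier G" "w' \<in> carrier G" "x \<in> carrier G" "y \<in> carrier G"
  shows "gromov_prod G S w x y \<le> gromov_prod G S w' x y + wd w w'"
proof -
  have "real (wd x w) \<le> wd x w' + wd w w'" "real (wd y w) \<le> wd y w' + wd w w'"
    using wd_triangle[of x w' w] wd_triangle[of y w' w] assms wd_commute[of w w'] by auto
  then show ?thesis unfolding gromov_prod_def by (simp add: field_simps)
qed

section \<open>Linear growth\<close>

text \<open>Infinitely many cosets of \<open>generate G {g}\<close> would give more than
  \<open>A * wd \<one> g\<close> disjoint rays \<open>g [^] i \<otimes> r c\<close>, and balls would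
  then contain more points than the slope \<open>A\<close> allows.\<close>

lemma linear_growth_finite_index:
  assumes g: "g \<in> carrier G" and inf: "\<And>n::nat. n > 0 \<Longrightarrow> g [^] n \<noteq> \<one>"
    and growth: "\<And>n. card (wball n) \<le> A * n + B"
  shows "finite (RCOSETS G (generate G {g}))"
proof (rule ccontr)
  let ?H = "generate G {g}"
  assume "infinite (RCOSETS G ?H)"
  then obtain T where T: "T \<subseteq> RCOSETS G ?H" "finite T" "card T = A * wd \<one> g + 1"
    using infinite_arbitrarily_large by meson
  have H: "subgroup ?H G" using g by (simp add: generate_is_subgroup)
  have "\<forall>c\<in>T. \<exists>r. r \<in> carrier G \<and> c = ?H #> r"
    using T(1) by (auto simp: RCOSETS_def)
  then obtain r where r: "\<And>c. c \<in> T \<Longrightarrow> r c \<in> carrier G \<and> c = ?H #> r c" by metis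
  define M where "M = (\<Sum>c\<in>T. wd \<one> (r c))"
  have rM: "r c \<in> wball M" if "c \<in> T" for c
    using r[OF that] that T(2) by (auto simp: M_def intro: member_le_sum)
  \<comment> \<open>With one coset more than \<open>A * wd \<one> g\<close>, this \<open>n\<close>
    makes the count \<open>(n + 1) * card T\<close> exceed the growth bound by
    \<open>A * wd \<one> g + 1\<close>.\<close>
  define n where "n = A * M + B"
  let ?f = "\<lambda>(i::nat, c). g [^] i \<otimes> r c"
  have pow_H: "g [^] i \<in> ?H" for i :: nat
    using H generate.incl[of g "{g}" G] by (induction i) (auto simp: subgroup.m_closed subgroup.one_closed)
  have pow_inj: "i = j" if eq: "g [^] i = g [^] j" for i j :: nat
  proof -
    have "a = b" if "a \<le> b" "g [^] a = g [^] b" for a b :: nat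
    proof -
      have "g [^] (b - a) \<otimes> g [^] a = g [^] b" using that(1) g by (simp add: nat_pow_mult)
      then have "g [^] (b - a) = \<one>" using that g by (metis l_one nat_pow_closed one_closed right_cancel)
      then show ?thesis using inf[of "b - a"] that by fastforce
    qed
    then show ?thesis using eq by (metis nat_le_linear)
  qed
  \<comment> \<open>The coset recovers \<open>c\<close>; cancelling \<open>r c\<close> leaves a
    power of \<open>g\<close>, whose exponent is determined because \<open>g\<close> has infinite
    order.\<close>
  have "inj_on ?f ({..n} \<times> T)"
  proof (rule inj_onI, clarsimp)
    fix i j :: nat and c c' assume *: "c \<in> T" "c' \<in> T" "g [^] i \<otimes> r c = g [^] j \<otimes> r c'"
    have coset: "?H #> (g [^] k \<otimes> r e) = e" if "e \<in> T" for k :: nat and e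
    proof -
      have "?H #> (g [^] k \<otimes> r e) = ?H #> g [^] k #> r e"
        using r[OF that] g H by (simp add: coset_mult_assoc subgroup.subset)
      also have "?H #> g [^] k = ?H" using g H pow_H[of k] by (simp add: coset_join2)
      finally show ?thesis using r[OF that] by simp
    qed
    have "c = c'" using coset[OF *(1), of i] coset[OF *(2), of j] *(3) by simp
    moreover from this have "g [^] i = g [^] j" using * g r by simp
    ultimately show "i = j \<and> c = c'" using pow_inj by blast
  qed
  then have "(n + 1) * card T = card (?f ` ({..n} \<times> T))"
    by (simp add: card_image card_cartesian_product)
  also have "?f ` ({..n} \<times> T) \<subseteq> wball (n * wd \<one> g + M)"
  proof safe
    fix i c assume "i \<le> n" and "c \<in> T"
    then have "g [^] i \<in> wball (n * wd \<one> g)"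
      using wball_pow[OF g, of i] by (auto intro: order_trans[OF _ mult_le_mono1])
    then show "g [^] i \<otimes> r c \<in> carrier G" "wd \<one> (g [^] i \<otimes> r c) \<le> n * wd \<one> g + M"
      using wball_mult rM[OF \<open>c \<in> T\<close>] by auto
  qed
  then have "card (?f ` ({..n} \<times> T)) \<le> card (wball (n * wd \<one> g + M))"
    by (rule card_mono[OF finite_wball])
  also have "\<dots> \<le> A * (n * wd \<one> g + M) + B" by (rule growth)
  finally show False by (simp add: T(3) n_def algebra_simps)
qed

end

locale hyperbolic_group = word_metric +
  fixes \<delta> :: real
  assumes \<delta>_nonneg: "\<delta> \<ge> 0"
    and hyperbolic: "\<And>w x y z. \<lbrakk>w \<in> carrier G; x \<in> carrier G; y \<in> carrier G; z \<in> carrier G\<rbrakk> \<Longrightarrow>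
      gromov_prod G S w x z \<ge> min (gromov_prod G S w x y) (gromov_prod G S w y z) - \<delta>"
begin

abbreviation gp :: "'a \<Rightarrow> 'a \<Rightarrow> 'a \<Rightarrow> real" where "gp \<equiv> gromov_prod G S"

section \<open>Elements almost fixing a direction\<close>

text \<open>The point \<open>a \<otimes> y\<close> lies on a geodesic from \<open>a\<close> to
  \<open>a \<otimes> f\<close>. Since \<open>t\<close> exceeds \<open>M + \<delta>\<close>, it is
  far from the short side between \<open>\<one>\<close> and \<open>a\<close>, hence close to
  geodesics from \<open>\<one>\<close> to \<open>a \<otimes> f\<close>; up to depth
  \<open>t + M\<close> these follow geodesics to \<open>f\<close>.\<close>

lemma translated_geodesic_close:
  fixes M t :: nat
  assumes a: "a \<in> carrier G" "wd \<one> a \<le> M" and f: "f \<in> carrier G" "gp \<one> f (a \<otimes> f) \<ge> t + M"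
    and y: "y \<in> carrier G" "wd \<one> y = t" "wd y f = wd \<one> f - t" "t \<le> wd \<one> f"
    and t: "real t > M + \<delta>"
    and z: "z \<in> carrier G" "wd \<one> z = wd \<one> (a \<otimes> y)" "wd z f = wd \<one> f - wd \<one> z" "wd \<one> z \<le> wd \<one> f"
  shows "wd z (a \<otimes> y) \<le> 6 * \<delta>"
proof -
  define x where "x = a \<otimes> y"
  have x: "x \<in> carrier G" and af: "a \<otimes> f \<in> carrier G" using a y f x_def by auto
  have ax: "wd a x = t" using wd_left_mult[of a \<one> y] a y x_def by simp
  have xf: "wd x (a \<otimes> f) = wd \<one> f - t" using wd_left_mult[of a y f] a y f x_def by simp
  have aaf: "wd a (a \<otimes> f) = wd \<one> f" using wd_left_mult[of a \<one> f] a f by simp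
  \<comment> \<open>As \<open>x\<close> lies between \<open>a\<close> and
    \<open>a \<otimes> f\<close>, one of \<open>gp x a \<one>\<close> and
    \<open>gp x \<one> (a \<otimes> f)\<close> is at most \<delta>; the bound on \<open>t\<close>
    excludes the first.\<close>
  have "gp x a (a \<otimes> f) = 0"
    using ax xf aaf y(4) wd_commute[OF x af] by (simp add: gromov_prod_def)
  moreover have "gp x a (a \<otimes> f) \<ge> min (gp x a \<one>) (gp x \<one> (a \<otimes> f)) - \<delta>"
    using hyperbolic a x af by simp
  moreover have "gp x a \<one> \<ge> real t - M"
    using wd_triangle[of a \<one> x] wd_commute[of a \<one>] a x ax by (simp add: gromov_prod_def)
  ultimately have 1: "gp x \<one> (a \<otimes> f) \<le> \<delta>" using t by linarith
  have sM: "wd \<one> x \<le> t + M" using wd_triangle[of \<one> a x] a x ax by simp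
  \<comment> \<open>This is the identity \<open>gp \<one> x v + gp x \<one> v = wd \<one> x\<close>
    for \<open>v = a \<otimes> f\<close>.\<close>
  have 2: "gp \<one> x (a \<otimes> f) \<ge> wd \<one> x - \<delta>"
    using 1 wd_commute[of x \<one>] wd_commute[of "a \<otimes> f" \<one>] wd_commute[of "a \<otimes> f" x] x af
    by (simp add: gromov_prod_def)
  have 3: "gp \<one> (a \<otimes> f) f \<ge> wd \<one> x"
    using f sM gromov_prod_commute[of f "a \<otimes> f" \<one>] af by simp
  have 4: "gp \<one> f z = wd \<one> x"
    using z x_def f wd_commute[of z \<one>] wd_commute[of f \<one>] wd_commute[of z f]
    by (simp add: gromov_prod_def)
  \<comment> \<open>Chain from \<open>x\<close> through \<open>a \<otimes> f\<close> and
    \<open>f\<close> to \<open>z\<close>: two more losses of \<delta> after the one in fact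
    \<open>2\<close>. As \<open>x\<close> and \<open>z\<close> have equal length, the total loss
    doubles to the distance bound \<open>6 * \<delta>\<close>.\<close>
  have "gp \<one> x f \<ge> min (gp \<one> x (a \<otimes> f)) (gp \<one> (a \<otimes> f) f) - \<delta>"
    using hyperbolic x af f by simp
  moreover have "gp \<one> x z \<ge> min (gp \<one> x f) (gp \<one> f z) - \<delta>"
    using hyperbolic x z f by simp
  ultimately have "gp \<one> x z \<ge> wd \<one> x - 3 * \<delta>" using 2 3 4 \<delta>_nonneg by linarith
  then show ?thesis
    using z x_def x wd_commute[of x \<one>] wd_commute[of z \<one>] wd_commute[of x z]
    by (simp add: gromov_prod_def)
qed

text \<open>If a ball almost fixes the direction of \<open>f\<close>, then its elements \<open>a\<close> move a fixed point
  \<open>y\<close> of a geodesic to \<open>f\<close> uniformly close to that geodesic, so they are determined up to a bounded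
  error by the position \<open>wd \<one> (a \<otimes> y)\<close>, which ranges over an interval of length \<open>2 * M\<close>.\<close>

lemma card_wball_le_of_fixed_direction:
  assumes f: "f \<in> carrier G"
    and fixed: "\<And>a. a \<in> wball M \<Longrightarrow> a \<noteq> \<one> \<Longrightarrow> gp \<one> f (a \<otimes> f) \<ge> 3 * M + \<delta> + 2"
  shows "card (wball M) \<le> (2 * M + 1) * card (wball (nat \<lceil>6 * \<delta>\<rceil>))"
\<comment> \<open>On a trivial ball \<open>fixed\<close> is void. Otherwise a single
  \<open>a0\<close> already forces \<open>wd \<one> f\<close> to be at least \<open>t + M\<close>,
  so every position needed exists on the way to \<open>f\<close>.\<close>
proof (cases "wball M = {\<one>}")
  case True
  have "card (wball (nat \<lceil>6 * \<delta>\<rceil>)) > 0"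
    using finite_wball by (auto simp: card_gt_0_iff intro!: exI[of _ \<one>])
  then show ?thesis using True by simp
next
  case False
  \<comment> \<open>The least natural number above \<open>M + \<delta>\<close>, as
    \<open>translated_geodesic_close\<close> requires.\<close>
  define t where "t = M + nat \<lfloor>\<delta>\<rfloor> + 1"
  have "real (nat \<lfloor>\<delta>\<rfloor>) = of_int \<lfloor>\<delta>\<rfloor>" 
    using \<delta>_nonneg by simp
  then have t: "real t > M + \<delta>" "3 * M + \<delta> + 2 \<ge> t + M" unfolding t_def by (auto, linarith+)
  obtain a0 where a0: "a0 \<in> wball M" "a0 \<noteq> \<one>" using False by auto
  have "real (t + M) \<le> wd \<one> f"
    using fixed[OF a0] t(2) gromov_prod_le[of \<one> f "a0 \<otimes> f"] a0 f by simp
  then have tf: "t + M \<le> wd \<one> f" by linarith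
  \<comment> \<open>The points \<open>\<gamma> s\<close> are chosen separately and need not lie on
    one geodesic; only their distances to \<open>\<one>\<close> and \<open>f\<close> matter.\<close>
  have "\<forall>s. \<exists>z. s \<le> wd \<one> f \<longrightarrow> z \<in> carrier G \<and> wd \<one> z = s \<and> wd z f = wd \<one> f - s"
    using wd_geodesic[of \<one> f] f by blast
  then obtain \<gamma> where \<gamma>: "\<And>s. s \<le> wd \<one> f \<Longrightarrow> \<gamma> s \<in> carrier G \<and> wd \<one> (\<gamma> s) = s \<and> wd (\<gamma> s) f = wd \<one> f - s"
    by metis
  define y where "y = \<gamma> t"
  have y: "y \<in> carrier G" "wd \<one> y = t" "wd y f = wd \<one> f - t" using \<gamma>[of t] tf y_def by auto
  let ?F = "\<lambda>(s, b). \<gamma> s \<otimes> b \<otimes> inv y"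
  let ?D = "{t - M..t + M} \<times> wball (nat \<lceil>6 * \<delta>\<rceil>)"
  have "wball M \<subseteq> ?F ` ?D"
  proof
    fix a assume a: "a \<in> wball M"
    then have ac: "a \<in> carrier G" "wd \<one> a \<le> M" by auto
    define s where "s = wd \<one> (a \<otimes> y)"
    have ay: "a \<otimes> y \<in> carrier G" "wd a (a \<otimes> y) = t"
      using ac y wd_left_mult[of a \<one> y] by auto
    have s: "s \<le> t + M" "t - M \<le> s"
      using wd_triangle[of \<one> a "a \<otimes> y"] wd_triangle[of a \<one> "a \<otimes> y"] wd_commute[of a \<one>] ac ay s_def
      by auto
    have \<gamma>s: "\<gamma> s \<in> carrier G" "wd \<one> (\<gamma> s) = s" "wd (\<gamma> s) f = wd \<one> f - s"
      using \<gamma>[of s] s tf by auto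
    have "wd (\<gamma> s) (a \<otimes> y) \<le> 6 * \<delta>"
    proof (cases "a = \<one>")
      case True
      then show ?thesis using y s_def y_def \<delta>_nonneg by simp
    next
      case False
      have "gp \<one> f (a \<otimes> f) \<ge> t + M" using fixed[OF a False] t(2) by linarith
      then show ?thesis
        by (rule translated_geodesic_close[OF ac f _ y])
          (use \<gamma>s s tf t in \<open>auto simp: s_def\<close>)
    qed
    then have "wd \<one> (inv (\<gamma> s) \<otimes> (a \<otimes> y)) \<le> nat \<lceil>6 * \<delta>\<rceil>"
      using wd_one_inv_mult[OF \<gamma>s(1) ay(1)] by linarith
    moreover have "a = \<gamma> s \<otimes> (inv (\<gamma> s) \<otimes> (a \<otimes> y)) \<otimes> inv y"
      using \<gamma>s(1) ac y by (simp add: m_assoc[symmetric]) (simp add: m_assoc)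
    ultimately show "a \<in> ?F ` ?D"
      using s \<gamma>s(1) ay(1) by (intro image_eqI[of _ _ "(s, inv (\<gamma> s) \<otimes> (a \<otimes> y))"]) auto
  qed
  then have "card (wball M) \<le> card ?D"
    using finite_wball by (meson card_image_le card_mono finite_SigmaI finite_atLeastAtMost
        finite_imageI le_trans)
  also have "\<dots> = (2 * M + 1) * card (wball (nat \<lceil>6 * \<delta>\<rceil>))"
    by (simp add: card_cartesian_product t_def)
  finally show ?thesis .
qed

text \<open>Otherwise, for every \<open>M\<close>, the bound \<open>C = 3 * M + \<delta> + 2\<close>
  fails at some \<open>f\<close>. The counting lemma then gives linear growth, so
  \<open>generate G {g}\<close> has finite index, against \<open>nvc\<close>.\<close>

lemma ex_uniform_direction_change:
  assumes g: "g \<in> carrier G" "\<And>n::nat. n > 0 \<Longrightarrow> g [^] n \<noteq> \<one>" and nvc: "\<not> virtually_cyclic G"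
  shows "\<exists>M C. \<forall>f\<in>carrier G. \<exists>a\<in>wball M. a \<noteq> \<one> \<and> gp \<one> f (a \<otimes> f) \<le> C"
proof (rule ccontr)
  assume neg: "\<not> ?thesis"
  let ?N = "card (wball (nat \<lceil>6 * \<delta>\<rceil>))"
  have "card (wball M) \<le> (2 * ?N) * M + ?N" for M
  proof -
    have "\<exists>f\<in>carrier G. \<forall>a\<in>wball M. a \<noteq> \<one> \<longrightarrow> gp \<one> f (a \<otimes> f) \<ge> 3 * M + \<delta> + 2"
      using neg by (meson linorder_le_cases)
    then show ?thesis
      using card_wball_le_of_fixed_direction[of _ M] by (auto simp: algebra_simps)
  qed
  then have "finite (RCOSETS G (generate G {g}))"
    using linear_growth_finite_index[OF g, of "2 * ?N" ?N] by blast
  moreover have "subgroup (generate G {g}) G" using g by (simp add: generate_is_subgroup)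
  ultimately show False
    using nvc generate.incl[of g "{g}" G] unfolding virtually_cyclic_def by blast
qed

section \<open>Quasi-geodesics pass close to points of small Gromov product\<close>

text \<open>Applying hyperbolicity along a balanced binary tree loses \<delta> per level, so the
  loss is logarithmic in the number of steps.\<close>

lemma gromov_prod_dyadic_chain:
  assumes "w \<in> carrier G" "\<And>i. i \<in> {m..m + j} \<Longrightarrow> x i \<in> carrier G"
    and "\<And>i. i \<in> {m..<m + j} \<Longrightarrow> gp w (x i) (x (Suc i)) \<ge> B" and "0 < j" "j \<le> 2 ^ l"
  shows "gp w (x m) (x (m + j)) \<ge> B - l * \<delta>"
  using assms(2-)
proof (induction l arbitrary: m j)
  case 0
  then have "j = 1" by simp
  then show ?case using 0(2)[of m] by simp
next
  case (Suc l)
  show ?case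
  proof (cases "j \<le> 2 ^ l")
    case True
    then have "gp w (x m) (x (m + j)) \<ge> B - l * \<delta>" using Suc by blast
    then show ?thesis using \<delta>_nonneg by (simp add: algebra_simps)
  next
    case False
    define m' where "m' = m + 2 ^ l"
    have j: "m + j = m' + (j - 2 ^ l)" "2 ^ l < j" using False m'_def by auto
    have "gp w (x m) (x m') \<ge> B - l * \<delta>"
      unfolding m'_def using j by (intro Suc.IH Suc.prems(1,2)) auto
    moreover have "gp w (x m') (x (m' + (j - 2 ^ l))) \<ge> B - l * \<delta>"
      using Suc.prems(4) j(2) by (intro Suc.IH Suc.prems(1,2)) (auto simp: m'_def)
    moreover have "gp w (x m) (x (m + j)) \<ge> min (gp w (x m) (x m')) (gp w (x m') (x (m + j))) - \<delta>"
      using j(2) by (intro hyperbolic assms(1) Suc.prems(1)) (auto simp: m'_def)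
    ultimately show ?thesis using j(1) by (simp add: algebra_simps)
  qed
qed

text \<open>The loss along the block of indices between \<open>2 ^ k\<close> and \<open>2 ^ (k + 1)\<close> is at most \<open>k * \<delta>\<close>, and
  assembling the blocks starting from the last one costs another \<open>(k + 1) * \<delta>\<close> there.\<close>

lemma gromov_prod_escaping_chain:
  assumes w: "w \<in> carrier G" and x: "\<And>i. i \<le> n \<Longrightarrow> x i \<in> carrier G"
    and step: "\<And>k i. 2 ^ k \<le> i \<Longrightarrow> i < n \<Longrightarrow> gp w (x i) (x (Suc i)) \<ge> B + (2 * real k + 1) * \<delta>"
    and start: "gp w (x 0) (x (Suc 0)) \<ge> B" "gp w (x 0) (x 0) \<ge> B"
  shows "gp w (x 0) (x n) \<ge> B - \<delta>"
proof -
  have tail: "gp w (x (2 ^ k)) (x n) \<ge> B + k * \<delta>" if "2 ^ k < n" for k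
    using that
  proof (induction "n - 2 ^ k" arbitrary: k rule: less_induct)
    case less
    have block: "gp w (x (2 ^ k)) (x (2 ^ k + j)) \<ge> B + (k + 1) * \<delta>"
      if "0 < j" "j \<le> 2 ^ k" "2 ^ k + j \<le> n" for j
    proof -
      have "gp w (x (2 ^ k)) (x (2 ^ k + j)) \<ge> B + (2 * real k + 1) * \<delta> - k * \<delta>"
      proof (intro gromov_prod_dyadic_chain w)
        fix i assume "i \<in> {2 ^ k..<2 ^ k + j}"
        then show "gp w (x i) (x (Suc i)) \<ge> B + (2 * real k + 1) * \<delta>"
          using that by (intro step) auto
      qed (use that x in auto)
      then show ?thesis by (simp add: algebra_simps)
    qed
    show ?case
    proof (cases "n \<le> 2 ^ Suc k")
      case True
      then show ?thesis
        using block[of "n - 2 ^ k"] less.prems \<delta>_nonneg by (simp add: algebra_simps)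
    next
      case False
      have "n - 2 ^ Suc k < n - 2 ^ k" using less.prems by (intro diff_less_mono2) auto
      then have "gp w (x (2 ^ Suc k)) (x n) \<ge> B + Suc k * \<delta>"
        using False less.hyps[of "Suc k"] by simp
      moreover have "gp w (x (2 ^ k)) (x (2 ^ Suc k)) \<ge> B + (k + 1) * \<delta>"
        using block[of "2 ^ k"] False by (simp add: mult_2)
      moreover have "gp w (x (2 ^ k)) (x n) \<ge>
          min (gp w (x (2 ^ k)) (x (2 ^ Suc k))) (gp w (x (2 ^ Suc k)) (x n)) - \<delta>"
        using False less.prems by (intro hyperbolic w x) auto
      ultimately show ?thesis by (simp add: algebra_simps)
    qed
  qed
  \<comment> \<open>Index \<open>0\<close> lies in no dyadic block; joining it to the tail from
    index \<open>1\<close> costs the final \<delta>.\<close>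
  consider "n = 0" | "n = 1" | "n > 1" by linarith
  then show ?thesis
  proof cases
    case 3
    have "gp w (x 1) (x n) \<ge> B" using tail[of 0] 3 by simp
    moreover have "gp w (x 0) (x n) \<ge> min (gp w (x 0) (x 1)) (gp w (x 1) (x n)) - \<delta>"
      using 3 by (intro hyperbolic w x) auto
    ultimately show ?thesis using start(1) by simp
  qed (use start \<delta>_nonneg in auto)
qed

text \<open>If all vertices stayed far from \<open>w\<close>, the products of consecutive vertices
  would have lower bounds growing linearly with the index distance from the vertex nearest to
  \<open>w\<close>. This outweighs the logarithmic loss of chaining, so the product of the endpoints
  would exceed \<open>C\<close>.\<close>

lemma quasi_geodesic_near:
  assumes lam: "lam \<ge> 1"
  shows "\<exists>D::nat. \<forall>p w. quasi_geodesic G S lam c p \<longrightarrow> w \<in> carrier G \<longrightarrow>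
     gp w (hd p) (last p) \<le> C \<longrightarrow> (\<exists>v\<in>set p. wd w v \<le> D)"
proof -
  \<comment> \<open>Each half of the path loses \<delta> and joining the halves loses another, which
    leaves \<open>C + 1\<close>.\<close>
  define B where "B = C + 2 * \<delta> + 1"
  have "eventually (\<lambda>k::nat. (2 ^ k / lam - c) / 2 - 1 / 2 \<ge> B + (2 * real k + 1) * \<delta>) sequentially"
    using lam by real_asymp
  then obtain K where K: "\<And>k. k \<ge> K \<Longrightarrow> (2 ^ k / lam - c) / 2 - 1 / 2 \<ge> B + (2 * real k + 1) * \<delta>"
    unfolding eventually_sequentially by (auto simp: algebra_simps)
  \<comment> \<open>At index distances of at least \<open>2 ^ K\<close> the quasi-geodesic
    inequality suffices; \<open>D\<close> supplies the required distance at the smaller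
    scales.\<close>
  define D where "D = nat \<lceil>\<bar>B\<bar> + (2 * real K + 1) * \<delta> + 1\<rceil>"
  have D: "D \<ge> \<bar>B\<bar> + (2 * real K + 1) * \<delta> + 1" unfolding D_def by linarith
  have "\<exists>v\<in>set p. wd w v \<le> D"
    if p: "quasi_geodesic G S lam c p" and w: "w \<in> carrier G" and C: "gp w (hd p) (last p) \<le> C" for p w
  proof (rule ccontr)
    assume "\<not> ?thesis"
    then have far: "\<And>v. v \<in> set p \<Longrightarrow> wd w v > D" by (meson not_le)
    have path: "p \<noteq> []" "set p \<subseteq> carrier G"
      "\<And>i. Suc i < length p \<Longrightarrow> p ! Suc i = p ! i \<or> cayley_adj G S (p ! i) (p ! Suc i)"
      using p by (auto simp: quasi_geodesic_def cayley_path_def)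
    have pc: "\<And>i. i < length p \<Longrightarrow> p ! i \<in> carrier G" using path by auto
    have qg: "\<And>i j. \<lbrakk>i < length p; j < length p\<rbrakk> \<Longrightarrow> \<bar>real i - real j\<bar> / lam - c \<le> wd (p ! i) (p ! j)"
      using p by (auto simp: quasi_geodesic_def)
    have step: "wd (p ! i) (p ! Suc i) \<le> 1" if "Suc i < length p" for i
      using path(3)[OF that] wd_adjacent pc[of i] that by auto
    \<comment> \<open>Minimality of \<open>i0\<close> gives
      \<open>wd (p ! i) (p ! i0) \<le> 2 * wd w (p ! i)\<close>, the source of the division by
      \<open>2\<close> in \<open>away\<close>.\<close>
    define i0 where "i0 = (ARG_MIN (\<lambda>i. wd w (p ! i)) i. i < length p)"
    have i0: "i0 < length p" and i0_min: "\<And>i. i < length p \<Longrightarrow> wd w (p ! i0) \<le> wd w (p ! i)"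
      using arg_min_nat_lemma[of "\<lambda>i. i < length p" 0 "\<lambda>i. wd w (p ! i)"] path(1) i0_def by auto
    have away: "wd w (p ! i) \<ge> (\<bar>real i - real i0\<bar> / lam - c) / 2" if i: "i < length p" for i
    proof -
      have "real (wd (p ! i) (p ! i0)) \<le> wd w (p ! i) + wd w (p ! i0)"
        using wd_triangle[of "p ! i" w "p ! i0"] wd_commute[of w "p ! i"] pc i i0 w by simp
      then show ?thesis using qg[OF i i0] i0_min[OF i] by (simp add: field_simps)
    qed
    \<comment> \<open>A product of points at distance at most \<open>1\<close> falls short of the
      smaller distance to \<open>w\<close> by at most \<open>1 / 2\<close>.\<close>
    have lower: "gp w (p ! i) (p ! j) \<ge> Q"
      if "i < length p" "j < length p" "wd (p ! i) (p ! j) \<le> 1"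
        "wd w (p ! i) \<ge> Q + 1 / 2" "wd w (p ! j) \<ge> Q + 1 / 2" for i j and Q :: real
      using that wd_commute[of w "p ! i"] wd_commute[of w "p ! j"] pc w
      by (simp add: gromov_prod_def)
    have bound: "wd w (p ! i) \<ge> B + (2 * real k + 1) * \<delta> + 1 / 2"
      if i: "i < length p" "2 ^ k \<le> \<bar>real i - real i0\<bar>" for i k
    proof (cases "k \<ge> K")
      case True
      have "(2 ^ k / lam - c) / 2 \<le> (\<bar>real i - real i0\<bar> / lam - c) / 2"
        using i lam by (simp add: divide_right_mono)
      also have "\<dots> \<le> wd w (p ! i)" by (rule away[OF i(1)])
      finally show ?thesis using K[OF True] by linarith
    next
      case False
      have "(2 * real k + 1) * \<delta> \<le> (2 * real K + 1) * \<delta>"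
        using False \<delta>_nonneg by (intro mult_right_mono) auto
      moreover have "real (wd w (p ! i)) \<ge> D" using far[of "p ! i"] i by simp
      ultimately show ?thesis using D by simp
    qed
    have bound0: "wd w (p ! i) \<ge> B + 1 / 2" if i: "i < length p" for i
    proof -
      have "real (wd w (p ! i)) \<ge> D" using far[of "p ! i"] i by simp
      moreover have "(2 * real K + 1) * \<delta> \<ge> 0" using \<delta>_nonneg by simp
      ultimately show ?thesis using D by linarith
    qed
    have self: "gp w (p ! i0) (p ! i0) \<ge> B"
      using i0 pc[OF i0] bound0[OF i0] by (intro lower) auto
    let ?n = "length p - 1"
    have right: "gp w (p ! i0) (p ! ?n) \<ge> B - \<delta>"
    proof (cases "i0 = ?n")
      case True
      then show ?thesis using self \<delta>_nonneg by simp
    next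
      case False
      have "gp w (p ! (i0 + 0)) (p ! (i0 + (?n - i0))) \<ge> B - \<delta>"
      proof (rule gromov_prod_escaping_chain[where x = "\<lambda>i. p ! (i0 + i)", OF w])
        fix k i assume ki: "2 ^ k \<le> i" "i < ?n - i0"
        have "2 ^ k \<le> real i" using ki(1) of_nat_le_iff[of "2 ^ k" i, where 'a = real] by simp
        moreover from this have "2 ^ k \<le> 1 + real i" by linarith
        ultimately show "gp w (p ! (i0 + i)) (p ! (i0 + Suc i)) \<ge> B + (2 * real k + 1) * \<delta>"
          using ki step[of "i0 + i"] by (intro lower) (auto intro!: bound)
      qed (use i0 self False in \<open>auto intro!: pc lower step bound0\<close>)
      then show ?thesis using i0 by simp
    qed
    \<comment> \<open>The left half is read backwards, so that the chain again moves away from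
      \<open>i0\<close>.\<close>
    have left: "gp w (p ! i0) (p ! 0) \<ge> B - \<delta>"
    proof (cases "i0 = 0")
      case True
      then show ?thesis using self \<delta>_nonneg by simp
    next
      case False
      have step_back: "wd (p ! (i0 - i)) (p ! (i0 - Suc i)) \<le> 1" if "i < i0" for i
        using step[of "i0 - Suc i"] that i0 wd_commute[of "p ! (i0 - i)" "p ! (i0 - Suc i)"] pc
        by (simp add: Suc_diff_Suc)
      have "gp w (p ! (i0 - 0)) (p ! (i0 - i0)) \<ge> B - \<delta>"
      proof (rule gromov_prod_escaping_chain[where x = "\<lambda>i. p ! (i0 - i)", OF w])
        fix k i assume ki: "2 ^ k \<le> i" "i < i0"
        have "2 ^ k \<le> real i" using ki(1) of_nat_le_iff[of "2 ^ k" i, where 'a = real] by simp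
        moreover from this have "2 ^ k \<le> 1 + real i" by linarith
        ultimately show "gp w (p ! (i0 - i)) (p ! (i0 - Suc i)) \<ge> B + (2 * real k + 1) * \<delta>"
          using ki i0 step_back by (intro lower) (auto intro!: bound)
      next
        show "gp w (p ! (i0 - 0)) (p ! (i0 - Suc 0)) \<ge> B"
          using False i0 step_back[of 0] by (intro lower bound0) auto
      qed (use i0 self in \<open>auto intro!: pc\<close>)
      then show ?thesis by simp
    qed
    have "gp w (p ! 0) (p ! ?n) \<ge> min (gp w (p ! 0) (p ! i0)) (gp w (p ! i0) (p ! ?n)) - \<delta>"
      using i0 path(1) by (intro hyperbolic w pc) auto
    moreover have "gp w (p ! 0) (p ! i0) = gp w (p ! i0) (p ! 0)"
      using i0 path(1) by (intro gromov_prod_commute pc) auto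
    ultimately have "gp w (p ! 0) (p ! ?n) \<ge> B - 2 * \<delta>" using left right by simp
    then show False using C path(1) by (simp add: B_def hd_conv_nth last_conv_nth)
  qed
  then show ?thesis by blast
qed

end

section \<open>Left orders\<close>

locale ordered_group = group G for G (structure) +
  fixes P
  assumes cone: "positive_cone G P"
begin

lemma P_closed: "x \<in> P \<Longrightarrow> x \<in> carrier G"
  using cone by (auto simp: positive_cone_def)

lemma P_mult: "\<lbrakk>x \<in> P; y \<in> P\<rbrakk> \<Longrightarrow> x \<otimes> y \<in> P"
  using cone by (auto simp: positive_cone_def)

lemma P_cases: "x \<in> carrier G \<Longrightarrow> x \<noteq> \<one> \<Longrightarrow> x \<in> P \<or> inv x \<in> P"
  using cone P_closed by (auto simp: positive_cone_def)

lemma one_notin_P: "\<one> \<notin> P"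
  using cone by (auto simp: positive_cone_def)

lemma P_asym: "x \<in> P \<Longrightarrow> inv x \<notin> P"
  using P_mult[of x "inv x"] P_closed one_notin_P by auto

lemma P_pow: "\<lbrakk>x \<in> P; n > 0\<rbrakk> \<Longrightarrow> x [^] (n::nat) \<in> P"
proof (induction n)
  case (Suc n)
  then show ?case using P_mult P_closed by (cases "n = 0") auto
qed simp

text \<open>Right multiplication by a positive element raises an upper bound in the left order. If
  the new \<open>x\<close> equals the old bound \<open>f\<close>, take \<open>f \<otimes> q\<close>;
  if it is larger, take \<open>x \<otimes> q\<close>.\<close>

lemma ex_upper_bound:
  assumes "finite B" "B \<subseteq> carrier G" "P \<noteq> {}"
  shows "\<exists>f\<in>carrier G. \<forall>b\<in>B. inv b \<otimes> f \<in> P"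
  using assms(1,2)
proof induction
  case (insert x B)
  then obtain f where f: "f \<in> carrier G" "\<And>b. b \<in> B \<Longrightarrow> inv b \<otimes> f \<in> P" by auto
  obtain q where q: "q \<in> P" using assms(3) by blast
  have up: "inv b \<otimes> (h \<otimes> u) \<in> P"
    if "inv b \<otimes> h \<in> P" "u \<in> P" "b \<in> carrier G" "h \<in> carrier G" for b h u
    using that P_mult[of "inv b \<otimes> h" u] P_closed by (simp add: m_assoc)
  have x: "x \<in> carrier G" and B: "B \<subseteq> carrier G" using insert by auto
  have fq: "f \<otimes> q \<in> carrier G" "\<And>b. b \<in> B \<Longrightarrow> inv b \<otimes> (f \<otimes> q) \<in> P"
    using f q P_closed up B by auto
  consider "inv x \<otimes> f \<in> P" | "inv x \<otimes> f = \<one>" | "inv (inv x \<otimes> f) \<in> P"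
    using P_cases[of "inv x \<otimes> f"] f x by auto
  then show ?case
  proof cases
    case 1
    then show ?thesis using f by auto
  next
    case 2
    then have "inv x \<otimes> (f \<otimes> q) = q" using f x q P_closed by (simp add: m_assoc[symmetric])
    then show ?thesis using fq q by (intro bexI[of _ "f \<otimes> q"]) auto
  next
    case 3
    have "inv (inv x \<otimes> f) = inv f \<otimes> x" using f x by (simp add: inv_mult_group)
    then have "\<And>b. b \<in> B \<Longrightarrow> inv b \<otimes> (f \<otimes> (inv f \<otimes> x \<otimes> q)) \<in> P"
      using 3 up f q x B P_mult by auto
    moreover have "f \<otimes> (inv f \<otimes> x \<otimes> q) = x \<otimes> q"
      using f x q P_closed by (simp add: m_assoc[symmetric])
    moreover have "inv x \<otimes> (x \<otimes> q) = q" using x q P_closed by (simp add: m_assoc[symmetric])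
    ultimately show ?thesis using q x P_closed by (intro bexI[of _ "x \<otimes> q"]) auto
  qed
qed (use one_closed in blast)

end

section \<open>Contradiction from a supported combing\<close>

theorem theorem3p5:
  fixes G :: "('a, 'b) monoid_scheme" and S :: "'a set" and P :: "'a set"
  assumes "group G"
    and "finite S" and "S \<subseteq> carrier G" and "generate G S = carrier G"
    and "gromov_hyperbolic_group G S"
    and "\<not> virtually_cyclic G"
    and "positive_cone G P"
  shows "\<not> (\<exists>lam c r \<P>. lam \<ge> 1 \<and> c \<ge> 0 \<and> r \<ge> 0 \<and>
              qg_combing G S lam c P \<P> \<and> supported_nbhd G S r P \<P>)"
proof
  assume "\<exists>lam c r \<P>. lam \<ge> 1 \<and> c \<ge> 0 \<and> r \<ge> 0 \<and>
              qg_combing G S lam c P \<P> \<and> supported_nbhd G S r P \<P>"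
  then obtain lam c r \<P> where lam: "lam \<ge> 1" and r: "r \<ge> 0"
    and comb: "qg_combing G S lam c P \<P>" and supp: "supported_nbhd G S r P \<P>" by blast
  interpret group G by fact
  interpret ordered_group G P using assms by unfold_locales
  obtain \<delta> where \<delta>: "\<delta> \<ge> 0" "\<forall>w\<in>carrier G. \<forall>x\<in>carrier G. \<forall>y\<in>carrier G. \<forall>z\<in>carrier G.
        gromov_prod G S w x z \<ge> min (gromov_prod G S w x y) (gromov_prod G S w y z) - \<delta>"
    using assms(5) unfolding gromov_hyperbolic_group_def by blast
  interpret hyperbolic_group G S \<delta> using assms \<delta> by unfold_locales auto
  have P_ne: "P \<noteq> {}"
  proof
    assume "P = {}"
    then have triv: "carrier G = {\<one>\<^bsub>G\<^esub>}" using assms(7) by (auto simp: positive_cone_def)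
    have "generate G {\<one>\<^bsub>G\<^esub>} = {\<one>\<^bsub>G\<^esub>}" by (rule generate_one)
    moreover have "finite (RCOSETS G {\<one>\<^bsub>G\<^esub>})" by (simp add: RCOSETS_def triv)
    ultimately have "virtually_cyclic G"
      unfolding virtually_cyclic_def using triv_subgroup by (intro exI[of _ "{\<one>\<^bsub>G\<^esub>}"]) auto
    then show False using assms(6) by blast
  qed
  then obtain q where q: "q \<in> P" by blast
  have "q [^]\<^bsub>G\<^esub> n \<noteq> \<one>\<^bsub>G\<^esub>" if "n > 0" for n :: nat
    using P_pow[OF q that] one_notin_P by metis
  then obtain M C where MC: "\<And>f. f \<in> carrier G \<Longrightarrow>
      \<exists>a\<in>wball M. a \<noteq> \<one>\<^bsub>G\<^esub> \<and> gp \<one>\<^bsub>G\<^esub> f (a \<otimes>\<^bsub>G\<^esub> f) \<le> C"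
    using ex_uniform_direction_change[OF P_closed[OF q] _ assms(6)] by blast
  \<comment> \<open>The summand \<open>M\<close> leaves room for replacing \<open>a\<close> by its
    inverse. \<open>D\<close> is fixed before \<open>f\<close> is chosen.\<close>
  obtain D :: nat where D: "\<And>p w. \<lbrakk>quasi_geodesic G S lam c p; w \<in> carrier G;
      gp w (hd p) (last p) \<le> C + M\<rbrakk> \<Longrightarrow> \<exists>v\<in>set p. wd w v \<le> D"
    using quasi_geodesic_near[OF lam, of c "C + M"] by blast
  \<comment> \<open>The radius adds the distance \<open>D\<close> to a combing path and the distance
    from that path to \<open>P\<close>; the floor of \<open>r\<close> suffices since word distances
    are integers.\<close>
  obtain f where f: "f \<in> carrier G"
    and f_above: "\<And>b. b \<in> wball (D + nat \<lfloor>r\<rfloor>) \<Longrightarrow> inv\<^bsub>G\<^esub> b \<otimes>\<^bsub>G\<^esub> f \<in> P"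
    using ex_upper_bound[OF finite_wball _ P_ne, of "D + nat \<lfloor>r\<rfloor>"] by blast
  obtain a where a: "a \<in> carrier G" "wd \<one>\<^bsub>G\<^esub> a \<le> M" "a \<noteq> \<one>\<^bsub>G\<^esub>" "gp \<one>\<^bsub>G\<^esub> f (a \<otimes>\<^bsub>G\<^esub> f) \<le> C"
    using MC[OF f] by blast
  \<comment> \<open>The sign of \<open>h\<close> decides between the two candidates for
    \<open>k\<close>: the conjugate of \<open>inv a\<close> by \<open>f\<close> is the inverse of
    \<open>h\<close>.\<close>
  define h where "h = inv\<^bsub>G\<^esub> f \<otimes>\<^bsub>G\<^esub> (a \<otimes>\<^bsub>G\<^esub> f)"
  have h: "h \<in> carrier G" "h \<noteq> \<one>\<^bsub>G\<^esub>" "inv\<^bsub>G\<^esub> h = inv\<^bsub>G\<^esub> f \<otimes>\<^bsub>G\<^esub> (inv\<^bsub>G\<^esub> a \<otimes>\<^bsub>G\<^esub> f)"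
    using a f by (auto simp: h_def inv_mult_group m_assoc inv_solve_left' inv_solve_left)
  \<comment> \<open>Translation by \<open>a\<close> moves the base point to \<open>a\<close>; moving
    it back to the identity costs at most \<open>M\<close>.\<close>
  have gp_inv: "gp \<one>\<^bsub>G\<^esub> f (inv\<^bsub>G\<^esub> a \<otimes>\<^bsub>G\<^esub> f) \<le> C + M"
  proof -
    have "gp \<one>\<^bsub>G\<^esub> f (inv\<^bsub>G\<^esub> a \<otimes>\<^bsub>G\<^esub> f) = gp a (a \<otimes>\<^bsub>G\<^esub> f) f"
      using gromov_prod_left_mult[of a "\<one>\<^bsub>G\<^esub>" f "inv\<^bsub>G\<^esub> a \<otimes>\<^bsub>G\<^esub> f"] a f by (simp add: m_assoc[symmetric])
    also have "\<dots> \<le> gp \<one>\<^bsub>G\<^esub> (a \<otimes>\<^bsub>G\<^esub> f) f + wd a \<one>\<^bsub>G\<^esub>"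
      using a f by (intro gromov_prod_change_base) auto
    finally show ?thesis
      using a f gromov_prod_commute[of f "a \<otimes>\<^bsub>G\<^esub> f"] wd_commute[of a "\<one>\<^bsub>G\<^esub>"] by simp
  qed
  obtain k where k: "k \<in> carrier G" "gp \<one>\<^bsub>G\<^esub> f k \<le> C + M" "inv\<^bsub>G\<^esub> f \<otimes>\<^bsub>G\<^esub> k \<in> P"
  proof (cases "h \<in> P")
    case True
    then show thesis using that[of "a \<otimes>\<^bsub>G\<^esub> f"] a f h_def by simp
  next
    case False
    then show thesis using that[of "inv\<^bsub>G\<^esub> a \<otimes>\<^bsub>G\<^esub> f"] a f h P_cases[of h] gp_inv by simp
  qed
  obtain p where p: "p \<in> \<P>" "last p = inv\<^bsub>G\<^esub> f \<otimes>\<^bsub>G\<^esub> k"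
    using comb k(3) by (auto simp: qg_combing_def)
  have qg: "quasi_geodesic G S lam c p" "hd p = \<one>\<^bsub>G\<^esub>" using comb p by (auto simp: qg_combing_def)
  \<comment> \<open>Left translation by \<open>inv f\<close> carries the identity, \<open>f\<close>
    and \<open>k\<close> to \<open>inv f\<close>, \<open>hd p\<close> and
    \<open>last p\<close>.\<close>
  have "gp (inv\<^bsub>G\<^esub> f) (hd p) (last p) \<le> C + M"
    using gromov_prod_left_mult[of "inv\<^bsub>G\<^esub> f" "\<one>\<^bsub>G\<^esub>" f k] f k p qg by simp
  then obtain v where v: "v \<in> set p" "wd (inv\<^bsub>G\<^esub> f) v \<le> D" 
    using D[OF qg(1), of "inv\<^bsub>G\<^esub> f"] f by auto
  have vc: "v \<in> carrier G" using qg(1) v by (auto simp: quasi_geodesic_def cayley_path_def)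
  obtain u where u: "u \<in> P" "wd u v \<le> r" using supp p v by (auto simp: supported_nbhd_def)
  have "wd (inv\<^bsub>G\<^esub> f) u \<le> D + nat \<lfloor>r\<rfloor>"
  proof -
    have "wd u v \<le> nat \<lfloor>r\<rfloor>" using u(2) by (simp add: le_nat_floor)
    then show ?thesis
      using wd_triangle[of "inv\<^bsub>G\<^esub> f" v u] wd_commute[of u v] v vc f P_closed[OF u(1)] by simp
  qed
  \<comment> \<open>Membership in this ball places \<open>f \<otimes> u\<close> below
    \<open>f\<close>, so \<open>inv u\<close> is positive although \<open>u\<close> is.\<close>
  then have "f \<otimes>\<^bsub>G\<^esub> u \<in> wball (D + nat \<lfloor>r\<rfloor>)"
    using wd_one_inv_mult[of "inv\<^bsub>G\<^esub> f" u] f P_closed[OF u(1)] by simp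
  then have "inv\<^bsub>G\<^esub> (f \<otimes>\<^bsub>G\<^esub> u) \<otimes>\<^bsub>G\<^esub> f \<in> P" by (rule f_above)
  then have "inv\<^bsub>G\<^esub> u \<in> P" using f P_closed[OF u(1)] by (simp add: inv_mult_group m_assoc)
  then show False using P_asym[OF u(1)] by blast
qed

end
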